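(* Let $S$ be an oriented $C^1$ surface in $\mathbb{R}^3$ whose normal line congruence is parameterized by $\xi=\xi_0(\mu,\bar\mu)$, $\eta=\eta_0(\mu,\bar\mu)$, $r=r_0(\mu,\bar\mu)$. Hamilton's angle characteristic function for reflection in $S$ is \[ T(\xi_1,\xi_2)=\pm\frac{2|\xi_1-\xi_2|}{\left[(1+\xi_1\bar{\xi}_1)(1+\xi_2\bar{\xi}_2)\right]^{\frac12}}\,r_0, \] where $\xi_0$ is given by \[ \xi_0=\frac{\xi_1\bar{\xi}_1-\xi_2\bar{\xi}_2+|\xi_1-\xi_2|\,[(1+\xi_1\bar{\xi}_1)(1+\xi_2\bar{\xi}_2)]^{\frac12}}{\bar{\xi}_1(1+\xi_2\bar{\xi}_2)-\bar{\xi}_2(1+\xi_1\bar{\xi}_1)} \] and $(\xi_0,\eta_0,r_0)\in\Phi_S^{-1}(S)$.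
   Context: Oriented lines: $\mathbb{L}$ is the set of oriented affine lines in Euclidean $\mathbb{R}^3$, identified with the tangent bundle of the unit sphere $S^2=\mathbb{P}^1$. A direction (unit vector $v$) is described by the complex coordinate $\xi=\tan(\theta/2)e^{i\phi}$ (stereographic projection from the south pole), so $v_1+iv_2=\frac{2\xi}{1+\xi\bar\xi}$, $v_3=\frac{1-\xi\bar\xi}{1+\xi\bar\xi}$; throughout one works in the patch omitting the south direction. An oriented line has coordinates $(\xi,\eta)\in\mathbb{C}^2$, where $\xi$ is its direction and the tangent vector $\eta\,\partial_\xi+\bar\eta\,\partial_{\bar\xi}$ represents the perpendicular vector from the origin to the line. Write points of $\mathbb{R}^3$ as $(z,t)$ with $z=x^1+ix^2$, $t=x^3$. The map $\Phi:\mathbb{L}\times\mathbb{R}\to\mathbb{R}^3$ sends $((\xi,\eta),r)$ to the point on the line $(\xi,\eta)$ at signed affine parameter distance $r$ from the point of the line closest to the origin: \[ z=\frac{2(\eta-\bar\eta\xi^2)+2\xi(1+\xi\bar\xi)r}{(1+\xi\bar\xi)^2},\qquad t=\frac{-2(\eta\bar\xi+\bar\eta\xi)+(1-\xi^2\bar\xi^2)r}{(1+\xi\bar\xi)^2}. \] Surfaces: for an oriented $C^1$ surface $S\subset\mathbb{R}^3$, $\Phi_S^{-1}:S\to\mathbb{L}\times\mathbb{R}$ sends $p\in S$ to the oriented normal line $(\xi_0,\eta_0)$ to $S$ at $p$ together with the (signed) distance $r_0$ of $p$ from the point on that normal line closest to the origin. The normal congruence of $S$ is parameterized locally by a complex parameter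 $\mu$: $\xi_0(\mu,\bar\mu)$, $\eta_0(\mu,\bar\mu)$, $r_0(\mu,\bar\mu)$. Reflection: an oriented line with unit direction $v$ meeting $S$ at a point $p$ with unit normal $n$ is reflected to the oriented line through $p$ with direction $v-2(v\cdot n)n$. In coordinates, the incoming direction $\xi_1$, the normal direction $\xi_0$ and the reflected direction $\xi_2$ are related by $\xi_2=\frac{2\xi_0\bar\xi_1+1-\xi_0\bar\xi_0}{(1-\xi_0\bar\xi_0)\bar\xi_1-2\bar\xi_0}$. Angle characteristic function: for an incoming ray $(\xi_1,\eta_1)$ that is reflected in $S$ to $(\xi_2,\eta_2)$, let $q_1,q_2$ be the points on the incoming and reflected rays closest to the origin. $T$ takes the directions $\xi_1,\xi_2$ to the distance along the rays between $q_1$ and $q_2$ (via the reflection point). The points $q_i$ may lie on the opposite side of the surface, at points which the light never physically passes through; the associated distances are then counted negatively. $T$ is defined only for those $(\xi_1,\xi_2)$ for which such a ray exists, and may be multivalued, since there may be more than one such ray. The sign $\pm$ is an overall sign. *)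

theory Defs
  imports "HOL-Analysis.Analysis"
begin

text \<open>
  A point $(z,t)$ of $\mathbb{C} \times \mathbb{R}$ is the vector with components
  $(\mathrm{Re}\, z, \mathrm{Im}\, z, t)$.
\<close>

definition space_point :: "complex \<Rightarrow> real \<Rightarrow> real ^ 3" where
  "space_point z t = vector [Re z, Im z, t]"

text \<open>
  Unit vector with stereographic coordinate \<open>\<xi>\<close>, projecting from the south pole; the south
  direction $(0,0,-1)$ is the only one not in the range.
\<close>

definition direction :: "complex \<Rightarrow> real ^ 3" where
  "direction \<xi> = space_point
     (2 * \<xi> / of_real (1 + (cmod \<xi>)\<^sup>2))
     ((1 - (cmod \<xi>)\<^sup>2) / (1 + (cmod \<xi>)\<^sup>2))"

text \<open>
  The expression for $t$ is real although it is written with complex terms, so taking its real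
  part loses nothing.
\<close>

definition Phi :: "complex \<Rightarrow> complex \<Rightarrow> real \<Rightarrow> real ^ 3" where
  "Phi \<xi> \<eta> r = space_point
     ((2 * (\<eta> - cnj \<eta> * \<xi>\<^sup>2) + 2 * \<xi> * (1 + \<xi> * cnj \<xi>) * of_real r) / (1 + \<xi> * cnj \<xi>)\<^sup>2)
     (Re ((- 2 * (\<eta> * cnj \<xi> + cnj \<eta> * \<xi>) + (1 - \<xi>\<^sup>2 * (cnj \<xi>)\<^sup>2) * of_real r)
          / (1 + \<xi> * cnj \<xi>)\<^sup>2))"

definition line_points :: "complex \<Rightarrow> complex \<Rightarrow> (real ^ 3) set" where
  "line_points \<xi> \<eta> = range (Phi \<xi> \<eta>)"

text \<open>
  \<open>S\<close> is an embedded surface with $C^1$ charts, whose parameter plane is \<open>complex\<close>, and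
  \<open>\<nu>\<close> is a continuous unit normal field giving the orientation.
\<close>

definition oriented_C1_surface :: "(real ^ 3) set \<Rightarrow> (real ^ 3 \<Rightarrow> real ^ 3) \<Rightarrow> bool" where
  "oriented_C1_surface S \<nu> \<longleftrightarrow>
     continuous_on S \<nu> \<and> (\<forall>p\<in>S. norm (\<nu> p) = 1) \<and>
     (\<forall>p\<in>S. \<exists>U W (f :: complex \<Rightarrow> real ^ 3) g (D :: complex \<Rightarrow> complex \<Rightarrow>\<^sub>L (real ^ 3)).
        open U \<and> open W \<and> p \<in> W \<and> homeomorphism U (S \<inter> W) f g \<and>
        (\<forall>\<mu>\<in>U. (f has_derivative blinfun_apply (D \<mu>)) (at \<mu>)) \<and> continuous_on U D \<and>
        (\<forall>\<mu>\<in>U. inj (blinfun_apply (D \<mu>)) \<and> (\<forall>h. blinfun_apply (D \<mu>) h \<bullet> \<nu> (f \<mu>) = 0)))"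

text \<open>
  The image $\Phi_S^{-1}(S)$. Points of \<open>S\<close> whose normal is the south direction have no
  coordinates in the chart and do not contribute.
\<close>

definition Phi_inv :: "(real ^ 3) set \<Rightarrow> (real ^ 3 \<Rightarrow> real ^ 3) \<Rightarrow> (complex \<times> complex \<times> real) set" where
  "Phi_inv S \<nu> = {(\<xi>, \<eta>, r). \<exists>p\<in>S. direction \<xi> = \<nu> p \<and> Phi \<xi> \<eta> r = p}"

text \<open>
  Injectivity is not required, so that multiply covering parameterizations are included.
\<close>

definition parameterizes_normal_congruence ::
  "(real ^ 3) set \<Rightarrow> (real ^ 3 \<Rightarrow> real ^ 3) \<Rightarrow> complex set \<Rightarrow>
   (complex \<Rightarrow> complex) \<Rightarrow> (complex \<Rightarrow> complex) \<Rightarrow> (complex \<Rightarrow> real) \<Rightarrow> bool" where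
  "parameterizes_normal_congruence S \<nu> U \<xi>\<^sub>0 \<eta>\<^sub>0 r\<^sub>0 \<longleftrightarrow>
     open U \<and> continuous_on U \<xi>\<^sub>0 \<and> continuous_on U \<eta>\<^sub>0 \<and> continuous_on U r\<^sub>0 \<and>
     (\<lambda>\<mu>. (\<xi>\<^sub>0 \<mu>, \<eta>\<^sub>0 \<mu>, r\<^sub>0 \<mu>)) ` U = Phi_inv S \<nu>"

definition reflect :: "real ^ 3 \<Rightarrow> real ^ 3 \<Rightarrow> real ^ 3" where
  "reflect n v = v - (2 * (v \<bullet> n)) *\<^sub>R n"

definition reflects_at ::
  "(real ^ 3) set \<Rightarrow> (real ^ 3 \<Rightarrow> real ^ 3) \<Rightarrow> real ^ 3 \<Rightarrow>
   complex \<Rightarrow> complex \<Rightarrow> complex \<Rightarrow> complex \<Rightarrow> bool" where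
  "reflects_at S \<nu> p \<xi>\<^sub>1 \<eta>\<^sub>1 \<xi>\<^sub>2 \<eta>\<^sub>2 \<longleftrightarrow>
     p \<in> S \<and> p \<in> line_points \<xi>\<^sub>1 \<eta>\<^sub>1 \<and> p \<in> line_points \<xi>\<^sub>2 \<eta>\<^sub>2 \<and>
     direction \<xi>\<^sub>2 = reflect (\<nu> p) (direction \<xi>\<^sub>1)"

text \<open>
  The distance from \<open>q\<^sub>1\<close> to the reflection point \<open>p\<close> and on to \<open>q\<^sub>2\<close>. Each leg is measured along
  the direction of its ray, which makes it negative when \<open>q\<^sub>1\<close> lies ahead of \<open>p\<close> on the incoming
  line, or \<open>q\<^sub>2\<close> behind \<open>p\<close> on the reflected line.
\<close>

definition path_length ::
  "real ^ 3 \<Rightarrow> complex \<Rightarrow> complex \<Rightarrow> complex \<Rightarrow> complex \<Rightarrow> real" where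
  "path_length p \<xi>\<^sub>1 \<eta>\<^sub>1 \<xi>\<^sub>2 \<eta>\<^sub>2 =
     (let q\<^sub>1 = closest_point (line_points \<xi>\<^sub>1 \<eta>\<^sub>1) 0;
          q\<^sub>2 = closest_point (line_points \<xi>\<^sub>2 \<eta>\<^sub>2) 0
      in (p - q\<^sub>1) \<bullet> direction \<xi>\<^sub>1 + (q\<^sub>2 - p) \<bullet> direction \<xi>\<^sub>2)"

text \<open>
  The angle characteristic is multivalued and only partially defined, so it is represented by its
  set of values. That set is empty when no ray with direction \<open>\<xi>\<^sub>1\<close> is reflected to one with
  direction \<open>\<xi>\<^sub>2\<close>. Rays may meet \<open>S\<close> from either side.
\<close>

definition angle_characteristic ::
  "(real ^ 3) set \<Rightarrow> (real ^ 3 \<Rightarrow> real ^ 3) \<Rightarrow> complex \<Rightarrow> complex \<Rightarrow> real set" where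
  "angle_characteristic S \<nu> \<xi>\<^sub>1 \<xi>\<^sub>2 =
     {path_length p \<xi>\<^sub>1 \<eta>\<^sub>1 \<xi>\<^sub>2 \<eta>\<^sub>2 | p \<eta>\<^sub>1 \<eta>\<^sub>2. reflects_at S \<nu> p \<xi>\<^sub>1 \<eta>\<^sub>1 \<xi>\<^sub>2 \<eta>\<^sub>2}"

text \<open>
  Rays crossing \<open>S\<close> along and against the orientation are reflected alike, but the formula for
  the normal direction in terms of \<open>\<xi>\<^sub>1\<close> and \<open>\<xi>\<^sub>2\<close> selects one of the two unit normals. For
  \<open>\<sigma> = 1\<close> the orienting normal has the direction \<open>\<zeta>\<close>, for \<open>\<sigma> = -1\<close> it has the opposite
  direction, whose coordinate is $-1/\bar\zeta$. The latter is equivalent to reversing the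
  orientation, which changes the sign of the distance along the normal.
\<close>

definition oriented_direction :: "real \<Rightarrow> complex \<Rightarrow> complex" where
  "oriented_direction \<sigma> \<zeta> = (if \<sigma> = 1 then \<zeta> else - 1 / cnj \<zeta>)"

end

theory Submission
  imports Defs
begin

text \<open>
  Write \<open>v\<^sub>1\<close>, \<open>v\<^sub>2\<close> for the unit vectors with coordinates \<open>\<xi>\<^sub>1\<close>, \<open>\<xi>\<^sub>2\<close>. The point of an oriented line
  closest to the origin is perpendicular to the direction of the line, so the two foot points drop
  out of the path length, and a ray reflected at \<open>p\<close> has path length \<open>p \<bullet> (v\<^sub>1 - v\<^sub>2)\<close>. Reflection
  forces \<open>v\<^sub>1 - v\<^sub>2\<close> to be a multiple of the normal at \<open>p\<close>, hence the normal is \<open>n\<close> or \<open>-n\<close>, where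
  \<open>n\<close> is the normalization of \<open>v\<^sub>1 - v\<^sub>2\<close>. As the distance of \<open>p\<close> along its normal line is the inner
  product of \<open>p\<close> with the normal, the path length is \<open>norm (v\<^sub>1 - v\<^sub>2)\<close> times that distance, up to
  the sign that relates the normal to \<open>n\<close>.

  What remains is stereographic bookkeeping: \<open>norm (v\<^sub>1 - v\<^sub>2)\<close> is the chordal distance of \<open>\<xi>\<^sub>1\<close>
  and \<open>\<xi>\<^sub>2\<close>, and \<open>\<zeta>\<close> is the coordinate of \<open>n\<close> (\<open>direction_diff_stereographic\<close>). The denominator in
  \<open>\<zeta>\<close> vanishes exactly if \<open>v\<^sub>1 - v\<^sub>2\<close> is vertical or zero; otherwise neither \<open>n\<close> nor \<open>-n\<close> is the
  south direction and both have coordinates, \<open>\<zeta>\<close> and its antipode. Finally, because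
  there is a line of any given direction through any given point (\<open>Phi_surj\<close>), every point with
  normal \<open>n\<close> or \<open>-n\<close> reflects some ray of direction \<open>v\<^sub>1\<close> to one of direction \<open>v\<^sub>2\<close>, and conversely
  every reflection point has coordinates in the normal congruence.
\<close>

section \<open>Points and stereographic directions\<close>

lemma space_point_inner: "space_point z t \<bullet> space_point w u = Re (z * cnj w) + t * u"
  by (simp add: space_point_def inner_vec_def sum_3 vector_3)

lemma space_point_diff: "space_point z t - space_point w u = space_point (z - w) (t - u)"
  by (simp add: space_point_def vec_eq_iff forall_3 vector_3)

lemma space_point_add: "space_point z t + space_point w u = space_point (z + w) (t + u)"
  by (simp add: space_point_def vec_eq_iff forall_3 vector_3)

lemma space_point_scaleR: "c *\<^sub>R space_point z t = space_point (of_real c * z) (c * t)"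
  by (simp add: space_point_def vec_eq_iff forall_3 vector_3)

lemma space_point_surj: "\<exists>z t. p = space_point z t"
  by (rule exI[of _ "Complex (p $ 1) (p $ 2)"], rule exI[of _ "p $ 3"])
     (simp add: space_point_def vec_eq_iff forall_3 vector_3)

lemma one_plus_norm_square_pos: "1 + (cmod \<xi>)\<^sup>2 > 0"
  by (rule add_pos_nonneg) auto

lemma mult_cnj_eq: "\<xi> * cnj \<xi> = of_real (1 + (cmod \<xi>)\<^sup>2 - 1)"
  by (simp only: add_diff_cancel_left' complex_norm_square)

lemma norm_direction: "norm (direction \<xi>) = 1"
proof -
  define A where "A = 1 + (cmod \<xi>)\<^sup>2"
  have A: "A > 0" unfolding A_def by (rule one_plus_norm_square_pos)
  have "direction \<xi> \<bullet> direction \<xi> = Re (4 * (\<xi> * cnj \<xi>) / of_real (A\<^sup>2)) + ((2 - A) / A)\<^sup>2"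
    unfolding direction_def space_point_inner A_def[symmetric]
    by (simp add: A_def power2_eq_square)
  also have "\<xi> * cnj \<xi> = of_real (A - 1)"
    unfolding A_def by (rule mult_cnj_eq)
  also have "Re (4 * of_real (A - 1) / of_real (A\<^sup>2)) = 4 * (A - 1) / A\<^sup>2"
    by (simp only: Re_divide_of_real) simp
  also have "4 * (A - 1) / A\<^sup>2 + ((2 - A) / A)\<^sup>2 = 1"
    using A by (simp add: field_simps power2_eq_square)
  finally show ?thesis by (simp add: norm_eq_1)
qed

lemma direction_antipode:
  assumes "\<zeta> \<noteq> 0"
  shows "direction (- 1 / cnj \<zeta>) = - direction \<zeta>"
proof -
  define a where "a = (cmod \<zeta>)\<^sup>2"
  have a: "a > 0" using assms by (simp add: a_def)
  have sq: "\<zeta> * cnj \<zeta> = of_real a" by (simp only: a_def complex_norm_square)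
  have n: "(cmod (- 1 / cnj \<zeta>))\<^sup>2 = 1 / a"
    by (simp add: a_def norm_divide power_divide)
  have ne: "complex_of_real (1 + a) \<noteq> 0" by (subst of_real_eq_0_iff) (use a in linarith)
  have inv: "- 1 / cnj \<zeta> = - \<zeta> / of_real a"
    unfolding sq[symmetric] using assms by (simp add: field_simps)
  have "2 * (- 1 / cnj \<zeta>) / of_real (1 + 1 / a) = - (2 * \<zeta> / of_real (1 + a))"
    unfolding inv using a ne by (simp add: field_simps)
  moreover have "(1 - 1 / a) / (1 + 1 / a) = - ((1 - a) / (1 + a))"
  proof -
    have "1 - 1 / a = (a - 1) / a" "1 + 1 / a = (1 + a) / a"
      using a by (simp_all add: field_simps)
    then show ?thesis using a by (simp add: minus_divide_left)
  qed
  ultimately show ?thesis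
    unfolding direction_def n a_def[symmetric]
    by (simp add: space_point_def vec_eq_iff forall_3 vector_3)
qed

section \<open>Oriented lines\<close>

lemma Phi_eq:
  "Phi \<xi> \<eta> r =
     space_point (2 * (\<eta> - cnj \<eta> * \<xi>\<^sup>2) / of_real ((1 + (cmod \<xi>)\<^sup>2)\<^sup>2))
                 (- 4 * Re (\<eta> * cnj \<xi>) / (1 + (cmod \<xi>)\<^sup>2)\<^sup>2)
       + r *\<^sub>R direction \<xi>"
proof -
  define a where "a = 1 + (cmod \<xi>)\<^sup>2"
  have a: "a > 0" unfolding a_def by (rule one_plus_norm_square_pos)
  have sq: "\<xi> * cnj \<xi> = of_real (a - 1)"
    unfolding a_def by (rule mult_cnj_eq)
  have z: "(2 * (\<eta> - cnj \<eta> * \<xi>\<^sup>2) + 2 * \<xi> * (1 + \<xi> * cnj \<xi>) * of_real r) / (1 + \<xi> * cnj \<xi>)\<^sup>2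
     = 2 * (\<eta> - cnj \<eta> * \<xi>\<^sup>2) / of_real (a\<^sup>2) + of_real r * (2 * \<xi> / of_real a)"
    unfolding sq using a by (simp add: field_simps power2_eq_square)
  have "- 2 * (\<eta> * cnj \<xi> + cnj \<eta> * \<xi>) = of_real (- 4 * Re (\<eta> * cnj \<xi>))"
    by (simp add: complex_eq_iff)
  moreover have "1 - \<xi>\<^sup>2 * (cnj \<xi>)\<^sup>2 = of_real (1 - (a - 1)\<^sup>2)"
    using arg_cong[OF sq, of "\<lambda>x. 1 - x\<^sup>2"] by (simp add: power_mult_distrib)
  moreover have "(1 + \<xi> * cnj \<xi>)\<^sup>2 = of_real (a\<^sup>2)"
    unfolding sq by simp
  ultimately have "(- 2 * (\<eta> * cnj \<xi> + cnj \<eta> * \<xi>) + (1 - \<xi>\<^sup>2 * (cnj \<xi>)\<^sup>2) * of_real r)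
          / (1 + \<xi> * cnj \<xi>)\<^sup>2
      = of_real ((- 4 * Re (\<eta> * cnj \<xi>) + (1 - (a - 1)\<^sup>2) * r) / a\<^sup>2)"
    by simp
  also have "(- 4 * Re (\<eta> * cnj \<xi>) + (1 - (a - 1)\<^sup>2) * r) / a\<^sup>2
      = - 4 * Re (\<eta> * cnj \<xi>) / a\<^sup>2 + r * ((2 - a) / a)"
    using a by (simp add: field_simps power2_eq_square)
  finally have t: "Re ((- 2 * (\<eta> * cnj \<xi> + cnj \<eta> * \<xi>) + (1 - \<xi>\<^sup>2 * (cnj \<xi>)\<^sup>2) * of_real r)
          / (1 + \<xi> * cnj \<xi>)\<^sup>2) = - 4 * Re (\<eta> * cnj \<xi>) / a\<^sup>2 + r * ((2 - a) / a)"
    by (simp only: Re_complex_of_real)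
  have "direction \<xi> = space_point (2 * \<xi> / of_real a) ((2 - a) / a)"
    unfolding direction_def a_def by simp
  then show ?thesis
    unfolding Phi_def z t by (simp only: space_point_add space_point_scaleR a_def)
qed

lemma Phi_affine: "Phi \<xi> \<eta> r = Phi \<xi> \<eta> 0 + r *\<^sub>R direction \<xi>"
  by (simp add: Phi_eq)

text \<open>
  \<open>Phi \<xi> \<eta> 0\<close> is the image of \<open>\<eta>\<close> under the differential of the inverse stereographic projection
  at \<open>\<xi>\<close>, and a tangent vector to the unit sphere is perpendicular to its base point.
\<close>

lemma Phi_0_orthogonal_direction: "Phi \<xi> \<eta> 0 \<bullet> direction \<xi> = 0"
proof -
  define a where "a = 1 + (cmod \<xi>)\<^sup>2"
  have a: "a > 0" unfolding a_def by (rule one_plus_norm_square_pos)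
  have sq: "\<xi> * cnj \<xi> = of_real (a - 1)"
    unfolding a_def by (rule mult_cnj_eq)
  have "2 * (\<eta> - cnj \<eta> * \<xi>\<^sup>2) / of_real (a\<^sup>2) * cnj (2 * \<xi> / of_real a)
      = 4 * (\<eta> * cnj \<xi> - (\<xi> * cnj \<xi>) * (cnj \<eta> * \<xi>)) / of_real (a^3)"
    using a by (simp add: field_simps power2_eq_square power3_eq_cube)
  also have "\<dots> = 4 * (\<eta> * cnj \<xi> - of_real (a - 1) * cnj (\<eta> * cnj \<xi>)) / of_real (a^3)"
    unfolding sq by simp
  finally have "Re (2 * (\<eta> - cnj \<eta> * \<xi>\<^sup>2) / of_real (a\<^sup>2) * cnj (2 * \<xi> / of_real a))
      = 4 * (Re (\<eta> * cnj \<xi>) - (a - 1) * Re (\<eta> * cnj \<xi>)) / a^3"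
    by (simp only: Re_divide_of_real Re_complex_of_real) simp
  also have "\<dots> = 4 * Re (\<eta> * cnj \<xi>) / a\<^sup>2 * ((2 - a) / a)"
    using a by (simp add: power2_eq_square power3_eq_cube divide_simps) (simp add: algebra_simps)
  finally have z: "Re (2 * (\<eta> - cnj \<eta> * \<xi>\<^sup>2) / of_real (a\<^sup>2) * cnj (2 * \<xi> / of_real a))
      = 4 * Re (\<eta> * cnj \<xi>) / a\<^sup>2 * ((2 - a) / a)" .
  have d: "direction \<xi> = space_point (2 * \<xi> / of_real a) ((2 - a) / a)"
    unfolding direction_def a_def by simp
  show ?thesis
    unfolding Phi_eq a_def[symmetric] scaleR_zero_left add_0_right
    unfolding d space_point_inner z by (simp only: minus_divide_left[symmetric] mult_minus_left)
qed

lemma Phi_inner_direction: "Phi \<xi> \<eta> r \<bullet> direction \<xi> = r"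
proof -
  have "direction \<xi> \<bullet> direction \<xi> = 1"
    using norm_direction norm_eq_1 by blast
  then show ?thesis
    by (subst Phi_affine) (simp add: inner_add_left Phi_0_orthogonal_direction)
qed

text \<open>
  The witness for \<open>r\<close> is the component of the point \<open>(z, t)\<close> along \<open>direction \<xi>\<close>. The witness for \<open>\<eta>\<close>
  is the image of the remaining, perpendicular part under the differential of the stereographic
  projection.
\<close>

lemma Phi_surj: "\<exists>\<eta> r. Phi \<xi> \<eta> r = p"
proof -
  obtain z t where p: "p = space_point z t" using space_point_surj by blast
  define a where "a = 1 + (cmod \<xi>)\<^sup>2"
  have a: "a > 0" unfolding a_def by (rule one_plus_norm_square_pos)
  have sq: "\<xi> * cnj \<xi> = of_real (a - 1)"
    unfolding a_def by (rule mult_cnj_eq)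
  define R where "R = Re (z * cnj \<xi>)"
  have zR: "z * cnj \<xi> + \<xi> * cnj z = of_real (2 * R)"
    by (simp add: R_def complex_eq_iff)
  \<comment> \<open>Solving \<open>Phi \<xi> \<eta> r = p\<close>, with \<open>R\<close> the horizontal part of \<open>p \<bullet> direction \<xi>\<close> times \<open>a / 2\<close>.\<close>
  define \<eta> where "\<eta> = (z - 2 * of_real t * \<xi> - cnj z * \<xi>\<^sup>2) / 2"
  define r where "r = (2 * R + (2 - a) * t) / a"
  have ar: "a * r = 2 * R + (2 - a) * t" using a by (simp add: r_def)
  have "2 * (\<eta> - cnj \<eta> * \<xi>\<^sup>2)
      = z - 2 * of_real t * \<xi> - z * \<xi>\<^sup>2 * (cnj \<xi>)\<^sup>2 * (-1)
          + (2 * of_real t * \<xi>) * (\<xi> * cnj \<xi>) - 2 * cnj z * \<xi>\<^sup>2"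
    unfolding \<eta>_def by (simp add: field_simps power2_eq_square)
  also have "\<dots> = z * (1 + (\<xi> * cnj \<xi>)\<^sup>2) - 2 * of_real t * \<xi> * (1 - \<xi> * cnj \<xi>)
      - 2 * \<xi> * ((z * cnj \<xi> + \<xi> * cnj z) - z * cnj \<xi>)"
    by (simp add: algebra_simps power2_eq_square)
  also have "\<dots> = z * (1 + (\<xi> * cnj \<xi>))\<^sup>2 - 2 * of_real t * \<xi> * (1 - \<xi> * cnj \<xi>)
      - 2 * \<xi> * (z * cnj \<xi> + \<xi> * cnj z)"
    by (simp add: algebra_simps power2_eq_square)
  also have "\<dots> = of_real (a\<^sup>2) * z - 2 * \<xi> * of_real (a * r)"
    unfolding sq zR ar by (simp add: algebra_simps power2_eq_square)
  finally have z: "2 * (\<eta> - cnj \<eta> * \<xi>\<^sup>2) / of_real (a\<^sup>2) + of_real r * (2 * \<xi> / of_real a) = z"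
    using a by (simp add: field_simps power2_eq_square)
  have "2 * (\<eta> * cnj \<xi>) = z * cnj \<xi> - 2 * of_real t * (\<xi> * cnj \<xi>) - (\<xi> * cnj \<xi>) * cnj (z * cnj \<xi>)"
    unfolding \<eta>_def by (simp add: algebra_simps power2_eq_square diff_divide_distrib)
  then have "Re (2 * (\<eta> * cnj \<xi>)) = R - 2 * t * (a - 1) - (a - 1) * R"
    unfolding sq R_def by simp
  then have "4 * Re (\<eta> * cnj \<xi>) = 2 * (R - 2 * t * (a - 1) - (a - 1) * R)"
    by simp
  then have t: "- 4 * Re (\<eta> * cnj \<xi>) / a\<^sup>2 + r * ((2 - a) / a) = t"
    using a unfolding r_def
    by (simp add: power2_eq_square divide_simps) (simp add: algebra_simps)
  have d: "direction \<xi> = space_point (2 * \<xi> / of_real a) ((2 - a) / a)"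
    unfolding direction_def a_def by simp
  have "Phi \<xi> \<eta> r = p"
    unfolding Phi_eq a_def[symmetric] p
    unfolding d space_point_scaleR space_point_add z t ..
  then show ?thesis by blast
qed

lemma mem_line_points: "\<exists>\<eta>. p \<in> line_points \<xi> \<eta>"
  using Phi_surj[of \<xi> p] unfolding line_points_def by auto

lemma closest_point_line_points: "closest_point (line_points \<xi> \<eta>) 0 = Phi \<xi> \<eta> 0"
proof -
  have d: "(dist 0 (Phi \<xi> \<eta> r))\<^sup>2 = (norm (Phi \<xi> \<eta> 0))\<^sup>2 + r\<^sup>2" for r
    using norm_direction[of \<xi>] Phi_0_orthogonal_direction[of \<xi> \<eta>]
    by (subst Phi_affine)
       (simp add: norm_add_Pythagorean orthogonal_def dist_0_norm)
  have le: "dist 0 (Phi \<xi> \<eta> 0) \<le> dist 0 (Phi \<xi> \<eta> s)" for s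
    by (rule power2_le_imp_le) (simp_all only: d zero_le_dist, simp)
  have uniq: "r = 0" if "dist 0 (Phi \<xi> \<eta> r) \<le> dist 0 (Phi \<xi> \<eta> 0)" for r
    using power_mono[OF that, of 2] zero_le_power2[of r] unfolding d by simp
  show ?thesis
    unfolding closest_point_def
    by (rule some_equality) (use le uniq in \<open>auto simp: line_points_def\<close>)
qed

section \<open>Path length and reflection\<close>

text \<open>
  The foot points of the two rays are perpendicular to the rays, so only the reflection point
  contributes.
\<close>

lemma path_length_eq: "path_length p \<xi>\<^sub>1 \<eta>\<^sub>1 \<xi>\<^sub>2 \<eta>\<^sub>2 = p \<bullet> (direction \<xi>\<^sub>1 - direction \<xi>\<^sub>2)"
  by (simp add: path_length_def Let_def closest_point_line_points
      inner_diff_left inner_diff_right Phi_0_orthogonal_direction)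

text \<open>
  A reflection moves \<open>v\<close> along \<open>n\<close>, so \<open>v - w\<close> determines the unit vector \<open>n\<close> up to sign. Conversely,
  \<open>v\<close> and \<open>w\<close> have the same length, so they have opposite components along \<open>v - w\<close>, and
  subtracting twice the component of \<open>v\<close> gives \<open>w\<close>.
\<close>

lemma reflect_eq_iff:
  assumes "norm v = 1" "norm w = 1" "norm n = 1" "norm m = 1" "v - w = c *\<^sub>R m" "c \<noteq> 0"
  shows "w = reflect n v \<longleftrightarrow> (\<exists>\<sigma>\<in>{1, -1}. n = \<sigma> *\<^sub>R m)"
proof
  assume "w = reflect n v"
  then have eq: "c *\<^sub>R m = (2 * (v \<bullet> n)) *\<^sub>R n"
    using assms(5) by (simp add: reflect_def)
  define k where "k = 2 * (v \<bullet> n) / c"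
  have m: "m = k *\<^sub>R n"
    using arg_cong[OF eq, of "\<lambda>x. (1 / c) *\<^sub>R x"] \<open>c \<noteq> 0\<close> by (simp add: k_def)
  then have "\<bar>k\<bar> = 1"
    using assms(3,4) by simp
  then have "k = 1 \<or> k = -1" by linarith
  then show "\<exists>\<sigma>\<in>{1, -1}. n = \<sigma> *\<^sub>R m"
    using m by auto
next
  assume "\<exists>\<sigma>\<in>{1, -1}. n = \<sigma> *\<^sub>R m"
  then have "reflect n v = reflect m v"
    by (auto simp: reflect_def)
  moreover have "2 * (v \<bullet> m) = c"
  proof -
    have w: "w = v - c *\<^sub>R m" using assms(5) by (simp add: algebra_simps)
    have "w \<bullet> w = 1" "v \<bullet> v = 1" "m \<bullet> m = 1"
      using assms(1,2,4) norm_eq_1 by blast+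
    then have "c * c = c * (2 * (v \<bullet> m))"
      unfolding w by (simp add: inner_diff_left inner_diff_right inner_commute algebra_simps)
    then show ?thesis using \<open>c \<noteq> 0\<close> by simp
  qed
  moreover have "w = v - c *\<^sub>R m"
    using assms(5) by (simp add: algebra_simps)
  ultimately show "w = reflect n v"
    by (simp only: reflect_def)
qed

text \<open>
  With \<open>A = 1 + |\<xi>\<^sub>1|\<^sup>2\<close>, \<open>B = 1 + |\<xi>\<^sub>2|\<^sup>2\<close> and \<open>w = B \<xi>\<^sub>1 - A \<xi>\<^sub>2\<close>, the difference of the two unit
  vectors is \<open>2 / (A B)\<close> times the vector \<open>(w, B - A)\<close>, whose length \<open>s\<close> satisfies
  \<open>s\<^sup>2 = |\<xi>\<^sub>1 - \<xi>\<^sub>2|\<^sup>2 A B\<close>. The stereographic coordinate of the normalized vector is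
  \<open>w / (s + B - A)\<close>, which is rewritten as \<open>(s + A - B) / cnj w\<close> by means of
  \<open>|w|\<^sup>2 = (s + B - A) (s + A - B)\<close>.
\<close>

lemma direction_diff_stereographic:
  fixes \<xi>\<^sub>1 \<xi>\<^sub>2 :: complex
  assumes "cnj \<xi>\<^sub>1 * (1 + \<xi>\<^sub>2 * cnj \<xi>\<^sub>2) - cnj \<xi>\<^sub>2 * (1 + \<xi>\<^sub>1 * cnj \<xi>\<^sub>1) \<noteq> 0"
  defines "\<zeta> \<equiv> (\<xi>\<^sub>1 * cnj \<xi>\<^sub>1 - \<xi>\<^sub>2 * cnj \<xi>\<^sub>2
            + of_real (cmod (\<xi>\<^sub>1 - \<xi>\<^sub>2) * sqrt ((1 + (cmod \<xi>\<^sub>1)\<^sup>2) * (1 + (cmod \<xi>\<^sub>2)\<^sup>2))))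
          / (cnj \<xi>\<^sub>1 * (1 + \<xi>\<^sub>2 * cnj \<xi>\<^sub>2) - cnj \<xi>\<^sub>2 * (1 + \<xi>\<^sub>1 * cnj \<xi>\<^sub>1))"
  shows "\<zeta> \<noteq> 0"
    and "direction \<xi>\<^sub>1 - direction \<xi>\<^sub>2 =
      (2 * cmod (\<xi>\<^sub>1 - \<xi>\<^sub>2) / sqrt ((1 + (cmod \<xi>\<^sub>1)\<^sup>2) * (1 + (cmod \<xi>\<^sub>2)\<^sup>2))) *\<^sub>R direction \<zeta>"
proof -
  define A where "A = 1 + (cmod \<xi>\<^sub>1)\<^sup>2"
  define B where "B = 1 + (cmod \<xi>\<^sub>2)\<^sup>2"
  have A: "A > 0" and B: "B > 0" unfolding A_def B_def by (rule one_plus_norm_square_pos)+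
  define w where "w = of_real B * \<xi>\<^sub>1 - of_real A * \<xi>\<^sub>2"
  define s where "s = cmod (\<xi>\<^sub>1 - \<xi>\<^sub>2) * sqrt (A * B)"
  have sq1: "\<xi>\<^sub>1 * cnj \<xi>\<^sub>1 = of_real (A - 1)" and sq2: "\<xi>\<^sub>2 * cnj \<xi>\<^sub>2 = of_real (B - 1)"
    unfolding A_def B_def by (rule mult_cnj_eq)+
  have den: "cnj \<xi>\<^sub>1 * (1 + \<xi>\<^sub>2 * cnj \<xi>\<^sub>2) - cnj \<xi>\<^sub>2 * (1 + \<xi>\<^sub>1 * cnj \<xi>\<^sub>1) = cnj w"
    unfolding sq1 sq2 w_def by simp
  have w: "w \<noteq> 0" using assms(1) unfolding den by simp
  have \<zeta>: "\<zeta> = of_real (s + A - B) / cnj w"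
    unfolding \<zeta>_def den A_def[symmetric] B_def[symmetric] s_def[symmetric]
    unfolding sq1 sq2 by (simp add: algebra_simps)
  have "s \<ge> 0" using A B unfolding s_def by simp
  have s2: "s\<^sup>2 = (cmod (\<xi>\<^sub>1 - \<xi>\<^sub>2))\<^sup>2 * (A * B)"
    using A B unfolding s_def by (simp add: power_mult_distrib)
  have w2: "(cmod w)\<^sup>2 = s\<^sup>2 - (B - A)\<^sup>2"
    unfolding s2 w_def A_def B_def cmod_power2
    by simp algebra
  then have prod: "(s + A - B) * (s + B - A) = (cmod w)\<^sup>2"
    by (simp add: algebra_simps power2_eq_square)
  have "(B - A)\<^sup>2 < s\<^sup>2" using w2 zero_less_power[of "cmod w" 2] w by simp
  then have "\<bar>B - A\<bar> < s" using \<open>s \<ge> 0\<close> by (simp add: power2_less_imp_less)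
  then have N: "s + A - B > 0" and N': "s + B - A > 0" by linarith+
  then have s: "s > 0" by linarith
  have N_ne: "complex_of_real (s + A - B) \<noteq> 0" by (subst of_real_eq_0_iff) (use N in linarith)
  show "\<zeta> \<noteq> 0" unfolding \<zeta> using N_ne w by simp
  have cz: "(cmod \<zeta>)\<^sup>2 = (s + A - B) / (s + B - A)"
  proof -
    have "(cmod \<zeta>)\<^sup>2 = (s + A - B)\<^sup>2 / (cmod w)\<^sup>2"
      unfolding \<zeta> norm_divide norm_of_real power_divide by simp
    also have "\<dots> = (s + A - B) / (s + B - A)"
      unfolding prod[symmetric] using N by (simp add: power2_eq_square)
    finally show ?thesis .
  qed
  have one_plus: "1 + (cmod \<zeta>)\<^sup>2 = 2 * s / (s + B - A)"
    unfolding cz using N' by (simp add: field_simps)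
  have one_minus: "1 - (cmod \<zeta>)\<^sup>2 = 2 * (B - A) / (s + B - A)"
    unfolding cz using N' by (simp add: field_simps)
  have \<zeta>': "\<zeta> = w / of_real (s + B - A)"
  proof -
    have "w * cnj w = of_real ((s + A - B) * (s + B - A))"
      unfolding prod by (simp only: complex_norm_square)
    moreover have "complex_of_real (s + B - A) \<noteq> 0" by (subst of_real_eq_0_iff) (use N' in linarith)
    ultimately show ?thesis
      unfolding \<zeta> using w by (simp add: frac_eq_eq)
  qed
  have "2 * \<zeta> / of_real (2 * s / (s + B - A)) = w / of_real s"
    unfolding \<zeta>' using s N' by (simp add: field_simps del: of_real_add of_real_diff)
  moreover have "(2 * (B - A) / (s + B - A)) / (2 * s / (s + B - A)) = (B - A) / s"
  proof -
    have "(2 * x / k) / (2 * s / k) = x / s" if "k > 0" for x k :: real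
      using that by simp
    then show ?thesis using N' by blast
  qed
  ultimately have dz: "direction \<zeta> = space_point (w / of_real s) ((B - A) / s)"
    unfolding direction_def one_plus one_minus by (simp only:)
  have c: "2 * cmod (\<xi>\<^sub>1 - \<xi>\<^sub>2) / sqrt (A * B) = 2 * s / (A * B)"
  proof -
    define S where "S = sqrt (A * B)"
    have "S > 0" "A * B = S * S" using A B by (simp_all add: S_def)
    then show ?thesis
      unfolding s_def S_def[symmetric] by (simp add: field_simps)
  qed
  have "2 * \<xi>\<^sub>1 / of_real A - 2 * \<xi>\<^sub>2 / of_real B = of_real (2 * s / (A * B)) * (w / of_real s)"
    unfolding w_def using A B s by (simp add: field_simps)
  moreover have "(2 - A) / A - (2 - B) / B = 2 * s / (A * B) * ((B - A) / s)"
    using A B s by (simp add: field_simps)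
  moreover have "direction \<xi>\<^sub>1 = space_point (2 * \<xi>\<^sub>1 / of_real A) ((2 - A) / A)"
    "direction \<xi>\<^sub>2 = space_point (2 * \<xi>\<^sub>2 / of_real B) ((2 - B) / B)"
    unfolding direction_def A_def B_def by simp_all
  ultimately show "direction \<xi>\<^sub>1 - direction \<xi>\<^sub>2 =
      (2 * cmod (\<xi>\<^sub>1 - \<xi>\<^sub>2) / sqrt ((1 + (cmod \<xi>\<^sub>1)\<^sup>2) * (1 + (cmod \<xi>\<^sub>2)\<^sup>2))) *\<^sub>R direction \<zeta>"
    unfolding A_def[symmetric] B_def[symmetric] c dz
    by (simp only: space_point_diff space_point_scaleR)
qed

section \<open>The angle characteristic function\<close>

theorem theorem3:
  fixes S :: "(real ^ 3) set" and \<nu> :: "real ^ 3 \<Rightarrow> real ^ 3"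
    and U :: "complex set" and \<xi>\<^sub>0 \<eta>\<^sub>0 :: "complex \<Rightarrow> complex" and r\<^sub>0 :: "complex \<Rightarrow> real"
    and \<xi>\<^sub>1 \<xi>\<^sub>2 \<zeta> :: complex
  assumes surface: "oriented_C1_surface S \<nu>"
    and congruence: "parameterizes_normal_congruence S \<nu> U \<xi>\<^sub>0 \<eta>\<^sub>0 r\<^sub>0"
    and denominator:
      "cnj \<xi>\<^sub>1 * (1 + \<xi>\<^sub>2 * cnj \<xi>\<^sub>2) - cnj \<xi>\<^sub>2 * (1 + \<xi>\<^sub>1 * cnj \<xi>\<^sub>1) \<noteq> 0"
    and normal_direction:
      "\<zeta> = (\<xi>\<^sub>1 * cnj \<xi>\<^sub>1 - \<xi>\<^sub>2 * cnj \<xi>\<^sub>2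
            + of_real (cmod (\<xi>\<^sub>1 - \<xi>\<^sub>2) * sqrt ((1 + (cmod \<xi>\<^sub>1)\<^sup>2) * (1 + (cmod \<xi>\<^sub>2)\<^sup>2))))
          / (cnj \<xi>\<^sub>1 * (1 + \<xi>\<^sub>2 * cnj \<xi>\<^sub>2) - cnj \<xi>\<^sub>2 * (1 + \<xi>\<^sub>1 * cnj \<xi>\<^sub>1))"
  shows "angle_characteristic S \<nu> \<xi>\<^sub>1 \<xi>\<^sub>2 =
    {\<sigma> * (2 * cmod (\<xi>\<^sub>1 - \<xi>\<^sub>2) / sqrt ((1 + (cmod \<xi>\<^sub>1)\<^sup>2) * (1 + (cmod \<xi>\<^sub>2)\<^sup>2))) * r\<^sub>0 \<mu> | \<sigma> \<mu>.
       \<sigma> \<in> {1, -1} \<and> \<mu> \<in> U \<and> \<xi>\<^sub>0 \<mu> = oriented_direction \<sigma> \<zeta> \<and>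
       (\<xi>\<^sub>0 \<mu>, \<eta>\<^sub>0 \<mu>, r\<^sub>0 \<mu>) \<in> Phi_inv S \<nu>}"
proof -
  define c where "c = 2 * cmod (\<xi>\<^sub>1 - \<xi>\<^sub>2) / sqrt ((1 + (cmod \<xi>\<^sub>1)\<^sup>2) * (1 + (cmod \<xi>\<^sub>2)\<^sup>2))"
  have "\<zeta> \<noteq> 0" and diff: "direction \<xi>\<^sub>1 - direction \<xi>\<^sub>2 = c *\<^sub>R direction \<zeta>"
    unfolding c_def normal_direction using direction_diff_stereographic[OF denominator] by auto
  have "\<xi>\<^sub>1 \<noteq> \<xi>\<^sub>2" using denominator by auto
  then have "c \<noteq> 0"
    using one_plus_norm_square_pos[of \<xi>\<^sub>1] one_plus_norm_square_pos[of \<xi>\<^sub>2]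
    by (simp add: c_def)
  \<comment> \<open>The sign \<open>\<sigma>\<close> tells which of the two unit normals \<open>\<nu>\<close> picks at the reflection point.\<close>
  have oriented: "direction (oriented_direction \<sigma> \<zeta>) = \<sigma> *\<^sub>R direction \<zeta>" if "\<sigma> \<in> {1, -1}" for \<sigma>
    using that direction_antipode[OF \<open>\<zeta> \<noteq> 0\<close>] by (auto simp: oriented_direction_def)
  have unit: "norm (\<nu> p) = 1" if "p \<in> S" for p
    using surface that by (simp add: oriented_C1_surface_def)
  have reflects: "direction \<xi>\<^sub>2 = reflect (\<nu> p) (direction \<xi>\<^sub>1) \<longleftrightarrow>
      (\<exists>\<sigma>\<in>{1, -1}. \<nu> p = direction (oriented_direction \<sigma> \<zeta>))" if "p \<in> S" for p
    using reflect_eq_iff[OF norm_direction norm_direction unit[OF that] norm_direction diff \<open>c \<noteq> 0\<close>]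
      oriented by auto
  have length: "path_length (Phi \<xi> \<eta> r) \<xi>\<^sub>1 \<eta>\<^sub>1 \<xi>\<^sub>2 \<eta>\<^sub>2 = \<sigma> * c * r"
    if "\<sigma> \<in> {1, -1}" "\<xi> = oriented_direction \<sigma> \<zeta>" for \<sigma> \<xi> \<eta> \<eta>\<^sub>1 \<eta>\<^sub>2 r
  proof -
    have "direction \<zeta> = \<sigma> *\<^sub>R direction \<xi>"
      using oriented that by auto
    then show ?thesis
      unfolding path_length_eq diff by (simp add: Phi_inner_direction)
  qed
  have image: "(\<lambda>\<mu>. (\<xi>\<^sub>0 \<mu>, \<eta>\<^sub>0 \<mu>, r\<^sub>0 \<mu>)) ` U = Phi_inv S \<nu>"
    using congruence by (simp add: parameterizes_normal_congruence_def)
  let ?T = "{\<sigma> * c * r\<^sub>0 \<mu> | \<sigma> \<mu>. \<sigma> \<in> {1, -1} \<and> \<mu> \<in> U \<and> \<xi>\<^sub>0 \<mu> = oriented_direction \<sigma> \<zeta> \<and>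
       (\<xi>\<^sub>0 \<mu>, \<eta>\<^sub>0 \<mu>, r\<^sub>0 \<mu>) \<in> Phi_inv S \<nu>}"
  have "angle_characteristic S \<nu> \<xi>\<^sub>1 \<xi>\<^sub>2 = ?T"
  proof (intro subset_antisym subsetI)
    fix T assume "T \<in> angle_characteristic S \<nu> \<xi>\<^sub>1 \<xi>\<^sub>2"
    then obtain p \<eta>\<^sub>1 \<eta>\<^sub>2 where T: "T = path_length p \<xi>\<^sub>1 \<eta>\<^sub>1 \<xi>\<^sub>2 \<eta>\<^sub>2"
      and "reflects_at S \<nu> p \<xi>\<^sub>1 \<eta>\<^sub>1 \<xi>\<^sub>2 \<eta>\<^sub>2"
      unfolding angle_characteristic_def by blast
    then have p: "p \<in> S" and "direction \<xi>\<^sub>2 = reflect (\<nu> p) (direction \<xi>\<^sub>1)"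
      unfolding reflects_at_def by auto
    then obtain \<sigma> where \<sigma>: "\<sigma> \<in> {1, -1}" and n: "\<nu> p = direction (oriented_direction \<sigma> \<zeta>)"
      using reflects[OF p] by blast
    obtain \<eta> r where \<eta>: "Phi (oriented_direction \<sigma> \<zeta>) \<eta> r = p"
      using Phi_surj by blast
    then have mem: "(oriented_direction \<sigma> \<zeta>, \<eta>, r) \<in> Phi_inv S \<nu>"
      using p n by (auto simp: Phi_inv_def)
    then obtain \<mu> where "\<mu> \<in> U" "(\<xi>\<^sub>0 \<mu>, \<eta>\<^sub>0 \<mu>, r\<^sub>0 \<mu>) = (oriented_direction \<sigma> \<zeta>, \<eta>, r)"
      using image by (metis (no_types, lifting) imageE)
    moreover have "T = \<sigma> * c * r"
      unfolding T \<eta>[symmetric] using length[OF \<sigma> refl] .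
    ultimately have "T = \<sigma> * c * r\<^sub>0 \<mu>" "\<mu> \<in> U" "\<xi>\<^sub>0 \<mu> = oriented_direction \<sigma> \<zeta>"
      "(\<xi>\<^sub>0 \<mu>, \<eta>\<^sub>0 \<mu>, r\<^sub>0 \<mu>) \<in> Phi_inv S \<nu>"
      using mem by simp_all
    then show "T \<in> ?T"
      using \<sigma> by blast
  next
    fix T assume "T \<in> ?T"
    then obtain \<sigma> \<mu> where T: "T = \<sigma> * c * r\<^sub>0 \<mu>" and \<sigma>: "\<sigma> \<in> {1, -1}"
      and \<xi>: "\<xi>\<^sub>0 \<mu> = oriented_direction \<sigma> \<zeta>" and mem: "(\<xi>\<^sub>0 \<mu>, \<eta>\<^sub>0 \<mu>, r\<^sub>0 \<mu>) \<in> Phi_inv S \<nu>"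
      by blast
    define p where "p = Phi (\<xi>\<^sub>0 \<mu>) (\<eta>\<^sub>0 \<mu>) (r\<^sub>0 \<mu>)"
    have p: "p \<in> S" and n: "direction (\<xi>\<^sub>0 \<mu>) = \<nu> p"
      using mem by (auto simp: Phi_inv_def p_def)
    obtain \<eta>\<^sub>1 \<eta>\<^sub>2 where "p \<in> line_points \<xi>\<^sub>1 \<eta>\<^sub>1" "p \<in> line_points \<xi>\<^sub>2 \<eta>\<^sub>2"
      using mem_line_points by blast
    moreover have "direction \<xi>\<^sub>2 = reflect (\<nu> p) (direction \<xi>\<^sub>1)"
      unfolding reflects[OF p] using \<sigma> \<xi> n[symmetric] by auto
    ultimately have "reflects_at S \<nu> p \<xi>\<^sub>1 \<eta>\<^sub>1 \<xi>\<^sub>2 \<eta>\<^sub>2"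
      unfolding reflects_at_def using p by blast
    moreover have "T = path_length p \<xi>\<^sub>1 \<eta>\<^sub>1 \<xi>\<^sub>2 \<eta>\<^sub>2"
      unfolding T p_def using length[OF \<sigma> \<xi>] by simp
    ultimately show "T \<in> angle_characteristic S \<nu> \<xi>\<^sub>1 \<xi>\<^sub>2"
      unfolding angle_characteristic_def by blast
  qed
  then show ?thesis unfolding c_def .
qed

end
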